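(* Let $G=(V,E)$ be a connected graph with growth function $\gamma(r)=\sup\{|B_v(r)|: v\in V\}$ satisfying $$\lim_{r\to\infty}\frac{\gamma(r)}{r^{k+1}}=0\quad\text{for some } k\in\mathbb N.$$ Then $\operatorname{asdim} G\le k$.
   Context: A connected graph $G=(V,E)$ is viewed as a geodesic metric space in which each edge has length $1$. For a subset $A\subset G$, $|A|$ denotes the number of vertices in $A$, and $B_v(r)$ is the ball of radius $r$ centered at $v$. The asymptotic dimension $\operatorname{asdim} X$ of a metric space $X$ is defined as follows: $\operatorname{asdim} X\le n$ if and only if for every $m>0$ there exist $D(m)>0$ and a covering $\mathcal U$ of $X$ by sets of diameter $\le D(m)$ such that any ball of radius $m$ in $X$ intersects at most $n+1$ elements of $\mathcal U$. *)

theory Defs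
  imports "HOL-Analysis.Analysis" "HOL-Library.Extended_Nat"
begin

section \<open>Connected graphs\<close>

definition simple_graph :: "'v set \<Rightarrow> 'v set set \<Rightarrow> bool" where
  "simple_graph V E \<longleftrightarrow> (\<forall>e\<in>E. e \<subseteq> V \<and> card e = 2)"

definition connected_graph :: "'v set \<Rightarrow> 'v set set \<Rightarrow> bool" where
  "connected_graph V E \<longleftrightarrow>
     simple_graph V E \<and> (\<forall>u\<in>V. \<forall>v\<in>V. (u, v) \<in> {(a, b). {a, b} \<in> E}\<^sup>*)"


section \<open>A graph as a geodesic metric space with edges of length 1\<close>

text \<open>Points of the geometric realization are given by barycentric coordinates: a vertex \<open>v\<close> is
  the indicator of \<open>v\<close>, and the point of an edge \<open>{u, v}\<close> at distance \<open>t\<close> from \<open>u\<close> has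
  coordinate \<open>1 - t\<close> at \<open>u\<close> and \<open>t\<close> at \<open>v\<close>.\<close>

definition vertex_point :: "'v \<Rightarrow> 'v \<Rightarrow> real" where
  "vertex_point v = (\<lambda>w. if w = v then 1 else 0)"

definition closed_edge :: "'v set \<Rightarrow> ('v \<Rightarrow> real) set" where
  "closed_edge e = {x. (\<forall>v. 0 \<le> x v) \<and> (\<forall>v. v \<notin> e \<longrightarrow> x v = 0) \<and> (\<Sum>v\<in>e. x v) = 1}"

definition graph_points :: "'v set \<Rightarrow> 'v set set \<Rightarrow> ('v \<Rightarrow> real) set" where
  "graph_points V E = vertex_point ` V \<union> (\<Union>e\<in>E. closed_edge e)"

text \<open>On \<open>e = {u, v}\<close> both summands below equal the difference of the arc-length parameters of
  \<open>x\<close> and \<open>y\<close>, hence the division by 2.\<close>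

definition segment_length :: "'v set \<Rightarrow> ('v \<Rightarrow> real) \<Rightarrow> ('v \<Rightarrow> real) \<Rightarrow> real" where
  "segment_length e x y = (\<Sum>v\<in>e. \<bar>x v - y v\<bar>) / 2"

text \<open>\<open>pl_path E x y l\<close>: there is a piecewise linear path from \<open>x\<close> to \<open>y\<close> of length \<open>l\<close>,
  each of whose finitely many pieces is a segment contained in a single edge.\<close>

inductive pl_path :: "'v set set \<Rightarrow> ('v \<Rightarrow> real) \<Rightarrow> ('v \<Rightarrow> real) \<Rightarrow> real \<Rightarrow> bool"
  for E :: "'v set set" where
  pl_path_refl: "pl_path E x x 0"
| pl_path_step: "e \<in> E \<Longrightarrow> x \<in> closed_edge e \<Longrightarrow> y \<in> closed_edge e \<Longrightarrow> pl_path E y z l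
     \<Longrightarrow> pl_path E x z (segment_length e x y + l)"

text \<open>Infimum of the lengths of the paths from \<open>x\<close> to \<open>y\<close>. The value 0 when there is no path never
  occurs for points of a connected graph; it makes the distance nonnegative on the whole type,
  as the locale \<^locale>\<open>Metric_space\<close> requires.\<close>

definition graph_dist :: "'v set set \<Rightarrow> ('v \<Rightarrow> real) \<Rightarrow> ('v \<Rightarrow> real) \<Rightarrow> real" where
  "graph_dist E x y = (if \<exists>l. pl_path E x y l then Inf {l. pl_path E x y l} else 0)"


section \<open>Growth function\<close>

definition vertex_count :: "'v set \<Rightarrow> ('v \<Rightarrow> real) set \<Rightarrow> ennreal" where
  "vertex_count V A = emeasure (count_space UNIV) {v\<in>V. vertex_point v \<in> A}"

definition growth :: "'v set \<Rightarrow> 'v set set \<Rightarrow> real \<Rightarrow> ennreal" where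
  "growth V E r = (SUP v\<in>V. vertex_count V
     (Metric_space.mcball (graph_points V E) (graph_dist E) (vertex_point v) r))"


section \<open>Asymptotic dimension\<close>

text \<open>The condition defining \<open>asdim X \<le> n\<close> for the metric space \<open>X\<close> with carrier \<open>M\<close> and
  distance \<open>d\<close>; \<^prop>\<open>\<forall>x\<in>A. \<forall>y\<in>A. d x y \<le> D\<close> says that \<open>A\<close> has diameter at most \<open>D\<close>.\<close>

definition asdim_at_most :: "'a set \<Rightarrow> ('a \<Rightarrow> 'a \<Rightarrow> real) \<Rightarrow> nat \<Rightarrow> bool" where
  "asdim_at_most M d n \<longleftrightarrow>
     (\<forall>m>0. \<exists>D>0. \<exists>\<U>. \<Union>\<U> = M \<and> (\<forall>A\<in>\<U>. \<forall>x\<in>A. \<forall>y\<in>A. d x y \<le> D) \<and>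
        (\<forall>c\<in>M. finite {A\<in>\<U>. A \<inter> Metric_space.mcball M d c m \<noteq> {}} \<and>
               card {A\<in>\<U>. A \<inter> Metric_space.mcball M d c m \<noteq> {}} \<le> n + 1))"

definition asdim :: "'a set \<Rightarrow> ('a \<Rightarrow> 'a \<Rightarrow> real) \<Rightarrow> enat" where
  "asdim M d = Inf {enat n | n. asdim_at_most M d n}"

lemma asdim_at_most_mono:
  assumes "asdim_at_most M d n" "n \<le> k"
  shows "asdim_at_most M d k"
  unfolding asdim_at_most_def
proof (intro allI impI)
  fix m :: real assume "m > 0"
  then obtain D \<U> where *: "D > 0" "\<Union>\<U> = M" "\<forall>A\<in>\<U>. \<forall>x\<in>A. \<forall>y\<in>A. d x y \<le> D"
    "\<forall>c\<in>M. finite {A\<in>\<U>. A \<inter> Metric_space.mcball M d c m \<noteq> {}} \<and>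
               card {A\<in>\<U>. A \<inter> Metric_space.mcball M d c m \<noteq> {}} \<le> n + 1"
    using assms(1) unfolding asdim_at_most_def by meson
  have "\<forall>c\<in>M. finite {A\<in>\<U>. A \<inter> Metric_space.mcball M d c m \<noteq> {}} \<and>
               card {A\<in>\<U>. A \<inter> Metric_space.mcball M d c m \<noteq> {}} \<le> k + 1"
    using *(4) assms(2) by (meson add_le_mono1 le_trans)
  with * show "\<exists>D>0. \<exists>\<U>. \<Union>\<U> = M \<and> (\<forall>A\<in>\<U>. \<forall>x\<in>A. \<forall>y\<in>A. d x y \<le> D) \<and>
        (\<forall>c\<in>M. finite {A\<in>\<U>. A \<inter> Metric_space.mcball M d c m \<noteq> {}} \<and>
               card {A\<in>\<U>. A \<inter> Metric_space.mcball M d c m \<noteq> {}} \<le> k + 1)"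
    by blast
qed

lemma asdim_le_iff: "asdim M d \<le> enat k \<longleftrightarrow> asdim_at_most M d k"
proof
  assume "asdim_at_most M d k"
  then show "asdim M d \<le> enat k"
    unfolding asdim_def by (intro Inf_lower) blast
next
  assume le: "asdim M d \<le> enat k"
  let ?S = "{enat n | n. asdim_at_most M d n}"
  have "?S \<noteq> {}"
    using le by (auto simp: asdim_def Inf_enat_def split: if_splits)
  then have "Inf ?S \<in> ?S"
    unfolding Inf_enat_def by (metis (mono_tags, lifting) LeastI_ex all_not_in_conv)
  then obtain n where "asdim M d = enat n" "asdim_at_most M d n"
    unfolding asdim_def by blast
  with le show "asdim_at_most M d k"
    using asdim_at_most_mono by force
qed


section \<open>The realization of a connected graph is a metric space\<close>

lemma finite_edge: "simple_graph V E \<Longrightarrow> e \<in> E \<Longrightarrow> finite e"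
  unfolding simple_graph_def by (metis card.infinite zero_neq_numeral)

lemma segment_length_commute: "segment_length e x y = segment_length e y x"
  by (simp add: segment_length_def abs_minus_commute)

lemma segment_length_nonneg: "segment_length e x y \<ge> 0"
  by (simp add: segment_length_def sum_nonneg)

lemma pl_path_nonneg: "pl_path E x y l \<Longrightarrow> l \<ge> 0"
  by (induction rule: pl_path.induct) (auto simp: segment_length_nonneg)

lemma pl_path_trans:
  assumes "pl_path E x y l" "pl_path E y z l'"
  shows "pl_path E x z (l + l')"
  using assms
proof (induction rule: pl_path.induct)
  case (pl_path_step e x y w l)
  then show ?case
    using pl_path.pl_path_step[of e E x y z "l + l'"] by (simp add: add.assoc)
qed simp

lemma pl_path_segment:
  assumes "e \<in> E" "x \<in> closed_edge e" "y \<in> closed_edge e"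
  shows "pl_path E x y (segment_length e x y)"
  using pl_path_step[OF assms pl_path_refl] by simp

lemma pl_path_sym: "pl_path E x y l \<Longrightarrow> pl_path E y x l"
proof (induction rule: pl_path.induct)
  case (pl_path_step e x y z l)
  then have "pl_path E y x (segment_length e x y)"
    using pl_path_segment[of e E y x] by (simp add: segment_length_commute)
  with pl_path_step.IH show ?case
    using pl_path_trans by (metis add.commute)
qed (rule pl_path_refl)

lemma vertex_point_closed_edge:
  assumes "simple_graph V E" "e \<in> E" "v \<in> e"
  shows "vertex_point v \<in> closed_edge e"
  using finite_edge[OF assms(1,2)] assms(3) by (auto simp: closed_edge_def vertex_point_def)

lemma pl_path_vertices:
  assumes "simple_graph V E" "(u, v) \<in> {(a, b). {a, b} \<in> E}\<^sup>*"
  shows "\<exists>l. pl_path E (vertex_point u) (vertex_point v) l"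
  using assms(2)
proof (induction rule: rtrancl_induct)
  case base
  then show ?case using pl_path_refl by blast
next
  case (step b c)
  then have "{b, c} \<in> E" by simp
  then have "pl_path E (vertex_point b) (vertex_point c)
      (segment_length {b, c} (vertex_point b) (vertex_point c))"
    using vertex_point_closed_edge[OF assms(1)] by (intro pl_path_segment) auto
  with step.IH show ?case using pl_path_trans by blast
qed

lemma pl_path_to_vertex:
  assumes "simple_graph V E" "x \<in> graph_points V E"
  shows "\<exists>v\<in>V. \<exists>l. pl_path E x (vertex_point v) l"
proof (cases "x \<in> vertex_point ` V")
  case True
  then show ?thesis using pl_path_refl by blast
next
  case False
  then obtain e where e: "e \<in> E" "x \<in> closed_edge e"
    using assms(2) by (auto simp: graph_points_def)
  then obtain v where v: "v \<in> e" "v \<in> V"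
    using assms(1) unfolding simple_graph_def by (metis card.empty ex_in_conv subsetD zero_neq_numeral)
  show ?thesis
    using pl_path_segment[OF e vertex_point_closed_edge[OF assms(1) e(1) v(1)]] v(2) by blast
qed

lemma pl_path_exists:
  assumes "connected_graph V E" "x \<in> graph_points V E" "y \<in> graph_points V E"
  shows "\<exists>l. pl_path E x y l"
proof -
  have g: "simple_graph V E" using assms(1) by (simp add: connected_graph_def)
  obtain u l1 where u: "u \<in> V" "pl_path E x (vertex_point u) l1"
    using pl_path_to_vertex[OF g assms(2)] by blast
  obtain v l2 where v: "v \<in> V" "pl_path E y (vertex_point v) l2"
    using pl_path_to_vertex[OF g assms(3)] by blast
  obtain l3 where "pl_path E (vertex_point u) (vertex_point v) l3"
    using pl_path_vertices[OF g] assms(1) u(1) v(1) unfolding connected_graph_def by blast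
  then show ?thesis
    using pl_path_trans u(2) v(2) pl_path_sym by metis
qed

lemma coordinate_diff_le_segment_length:
  assumes "card e = 2" "x \<in> closed_edge e" "y \<in> closed_edge e"
  shows "\<bar>x w - y w\<bar> \<le> segment_length e x y"
proof (cases "w \<in> e")
  case True
  then obtain v where e: "e = {w, v}" "v \<noteq> w"
    using assms(1) by (auto simp: card_2_iff)
  have "x w + x v = 1" "y w + y v = 1"
    using assms(2,3) e by (auto simp: closed_edge_def)
  then have "\<bar>x v - y v\<bar> = \<bar>x w - y w\<bar>" by linarith
  then show ?thesis using e by (simp add: segment_length_def)
next
  case False
  then have "x w = 0" "y w = 0"
    using assms(2,3) by (auto simp: closed_edge_def)
  then show ?thesis by (simp add: segment_length_nonneg)
qed

lemma coordinate_diff_le_pl_path: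
  assumes "simple_graph V E" "pl_path E x y l"
  shows "\<bar>x w - y w\<bar> \<le> l"
  using assms(2)
proof (induction rule: pl_path.induct)
  case (pl_path_step e x y z l)
  have "card e = 2" using pl_path_step.hyps(1) assms(1) by (auto simp: simple_graph_def)
  then have "\<bar>x w - y w\<bar> \<le> segment_length e x y"
    using coordinate_diff_le_segment_length pl_path_step.hyps(2,3) by metis
  then show ?case using pl_path_step.IH by linarith
qed simp

lemma graph_dist_le: "pl_path E x y l \<Longrightarrow> graph_dist E x y \<le> l"
  unfolding graph_dist_def
  by (auto intro!: cInf_lower bdd_belowI[of _ 0] dest: pl_path_nonneg)

lemma graph_dist_greatest:
  assumes "pl_path E x y l0" "\<And>l. pl_path E x y l \<Longrightarrow> a \<le> l"
  shows "a \<le> graph_dist E x y"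
proof -
  have "a \<le> Inf {l. pl_path E x y l}"
    using assms by (intro cInf_greatest) auto
  then show ?thesis using assms(1) by (auto simp: graph_dist_def)
qed

lemma Metric_space_graph:
  assumes "connected_graph V E"
  shows "Metric_space (graph_points V E) (graph_dist E)"
proof
  have g: "simple_graph V E" using assms by (simp add: connected_graph_def)
  show nonneg: "0 \<le> graph_dist E x y" for x y
  proof (cases "\<exists>l. pl_path E x y l")
    case True
    then show ?thesis using graph_dist_greatest pl_path_nonneg by blast
  qed (simp add: graph_dist_def)
  show "graph_dist E x y = graph_dist E y x" for x y
  proof -
    have "pl_path E x y = pl_path E y x" using pl_path_sym by blast
    then show ?thesis by (simp add: graph_dist_def)
  qed
  show "graph_dist E x y = 0 \<longleftrightarrow> x = y"
    if x: "x \<in> graph_points V E" and y: "y \<in> graph_points V E" for x y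
  proof
    assume 0: "graph_dist E x y = 0"
    obtain l0 where l0: "pl_path E x y l0" using pl_path_exists[OF assms x y] by blast
    show "x = y"
    proof
      fix w
      have "\<bar>x w - y w\<bar> \<le> graph_dist E x y"
        using graph_dist_greatest[OF l0] coordinate_diff_le_pl_path[OF g] by blast
      then show "x w = y w" using 0 by simp
    qed
  next
    assume "x = y"
    then show "graph_dist E x y = 0"
      using graph_dist_le[OF pl_path_refl, of E x] nonneg[of x x] by simp
  qed
  show "graph_dist E x z \<le> graph_dist E x y + graph_dist E y z"
    if x: "x \<in> graph_points V E" and y: "y \<in> graph_points V E" and z: "z \<in> graph_points V E"
    for x y z
  proof -
    obtain l1 where l1: "pl_path E x y l1" using pl_path_exists[OF assms x y] by blast
    obtain l2 where l2: "pl_path E y z l2" using pl_path_exists[OF assms y z] by blast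
    have "graph_dist E x z - l \<le> graph_dist E y z" if "pl_path E x y l" for l
    proof (rule graph_dist_greatest[OF l2])
      fix l' assume "pl_path E y z l'"
      then show "graph_dist E x z - l \<le> l'"
        using graph_dist_le[OF pl_path_trans[OF that]] by fastforce
    qed
    then have "graph_dist E x z - graph_dist E y z \<le> graph_dist E x y"
      by (intro graph_dist_greatest[OF l1]) (metis diff_le_eq add.commute)
    then show ?thesis by linarith
  qed
qed

end

theory Submission
  imports Defs
begin

text \<open>Fix \<open>m\<close> and call a set bounded if its \<open>m\<close>-chain components have bounded diameter. From a set
  \<open>A\<close> of vertices remove a separator \<open>Z\<close>, minimal subject to \<open>A - Z\<close> being bounded. Around each
  vertex there are \<open>N\<close> disjoint shells of width \<open>m\<close> with radii between \<open>r\<close> and \<open>r + N m\<close>; since \<open>Z\<close> could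
  be replaced inside a ball by the surrounding shell, minimality gives
  \<open>N |Z \<inter> B(v, r)| \<le> |A \<inter> B(v, r + N m)|\<close>. Starting from all vertices and passing \<open>k + 1\<close> times from \<open>A\<close>
  to \<open>Z\<close> leaves a set with at most \<open>\<gamma>((k + 1) N m) / N\<^sup>k\<^sup>+\<^sup>1\<close> vertices in any ball of radius 0. For
  suitable \<open>N\<close> this is below 1, so the set is empty, and the vertices are split into \<open>k + 1\<close> bounded
  sets. In an infinite graph minimality only makes sense on finite sets, and the separator is
  obtained by compactness.\<close>

lemma rado_selection:
  fixes X :: "'a set \<Rightarrow> 'a set"
  obtains Z where
    "\<And>F. finite F \<Longrightarrow> \<exists>G. finite G \<and> F \<subseteq> G \<and> Z \<inter> F = X G \<inter> F"
proof -
  have "compact_space (euclidean :: bool topology)"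
    by (simp add: compact_space_def finite_imp_compact)
  then have "compact_space (product_topology (\<lambda>i::'a. euclidean :: bool topology) UNIV)"
    by (simp only: compact_space_product_topology ball_UNIV simp_thms)
  then have "compact (UNIV :: ('a \<Rightarrow> bool) set)"
    by (simp add: euclidean_product_topology compact_space_def)
  then have ex: "\<exists>f\<in>UNIV. inf (nhds f) \<F> \<noteq> bot"
    if "\<F> \<noteq> bot" for \<F> :: "('a \<Rightarrow> bool) filter"
    using that unfolding compact_filter by simp
  define \<F> where "\<F> = filtermap (\<lambda>G x. x \<in> X G) (finite_subsets_at_top UNIV)"
  have "\<F> \<noteq> bot" by (simp add: \<F>_def filtermap_bot_iff)
  then obtain f where f: "inf (nhds f) \<F> \<noteq> bot" using ex by blast
  show ?thesis
  proof (rule that[of "{x. f x}"])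
    fix F :: "'a set" assume F: "finite F"
    show "\<exists>G. finite G \<and> F \<subseteq> G \<and> {x. f x} \<inter> F = X G \<inter> F"
    proof (rule ccontr)
      assume none: "\<not> (\<exists>G. finite G \<and> F \<subseteq> G \<and> {x. f x} \<inter> F = X G \<inter> F)"
      have differ: "\<not> (\<forall>x\<in>F. (x \<in> X G) = f x)" if "finite G" "F \<subseteq> G" for G
      proof
        assume "\<forall>x\<in>F. (x \<in> X G) = f x"
        then have "{x. f x} \<inter> F = X G \<inter> F" by auto
        then show False using none that by blast
      qed
      have "open {g. \<forall>x\<in>F. g x = f x}"
      proof -
        have "open (Pi\<^sub>E UNIV (\<lambda>x. if x \<in> F then {f x} else UNIV))"
          by (rule open_PiE) (auto simp: open_discrete intro: finite_subset[OF _ F])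
        moreover have "Pi\<^sub>E UNIV (\<lambda>x. if x \<in> F then {f x} else UNIV) = {g. \<forall>x\<in>F. g x = f x}"
          by (auto simp: PiE_iff split: if_splits)
        ultimately show ?thesis by simp
      qed
      then have "eventually (\<lambda>g. \<forall>x\<in>F. g x = f x) (nhds f)"
        unfolding eventually_nhds by (intro exI[of _ "{g. \<forall>x\<in>F. g x = f x}"]) auto
      then have agree: "eventually (\<lambda>g. \<forall>x\<in>F. g x = f x) (inf (nhds f) \<F>)"
        by (rule filter_leD[OF inf_le1])
      have "eventually (\<lambda>g. \<not> (\<forall>x\<in>F. g x = f x)) \<F>"
        unfolding \<F>_def eventually_filtermap eventually_finite_subsets_at_top
        using F differ by (intro exI[of _ F]) simp
      then have "eventually (\<lambda>g. \<not> (\<forall>x\<in>F. g x = f x)) (inf (nhds f) \<F>)"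
        by (rule filter_leD[OF inf_le2])
      with agree have "eventually (\<lambda>_. False) (inf (nhds f) \<F>)"
        by eventually_elim blast
      then show False using f by (simp add: eventually_False)
    qed
  qed
qed

context Metric_space
begin

definition step_rel :: "real \<Rightarrow> 'a set \<Rightarrow> ('a \<times> 'a) set" where
  "step_rel m S = {(x, y). x \<in> S \<and> y \<in> S \<and> d x y \<le> m}"

definition bounded_components :: "real \<Rightarrow> real \<Rightarrow> 'a set \<Rightarrow> bool" where
  "bounded_components m D S \<longleftrightarrow> (\<forall>x\<in>S. \<forall>y. (x, y) \<in> (step_rel m S)\<^sup>* \<longrightarrow> d x y \<le> D)"

lemma step_rel_mono: "S \<subseteq> T \<Longrightarrow> step_rel m S \<subseteq> step_rel m T"
  by (auto simp: step_rel_def)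

lemma step_rel_rtrancl_closed: "(x, y) \<in> (step_rel m S)\<^sup>* \<Longrightarrow> x \<in> S \<Longrightarrow> y \<in> S"
  by (induction rule: rtrancl_induct) (auto simp: step_rel_def)

lemma sym_step_rel: "sym (step_rel m S)"
  by (auto simp: step_rel_def sym_def commute)

lemma step_rel_rtrancl_finite:
  assumes "(x, y) \<in> (step_rel m S)\<^sup>*" "x \<in> S"
  obtains F where "finite F" "F \<subseteq> S" "x \<in> F" "(x, y) \<in> (step_rel m F)\<^sup>*"
proof -
  have "\<exists>F. finite F \<and> F \<subseteq> S \<and> x \<in> F \<and> (x, y) \<in> (step_rel m F)\<^sup>*"
    using assms
  proof (induction rule: rtrancl_induct)
    case base
    then show ?case by (intro exI[of _ "{x}"]) auto
  next
    case (step y z)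
    then obtain F where F: "finite F" "F \<subseteq> S" "x \<in> F" "(x, y) \<in> (step_rel m F)\<^sup>*" by blast
    let ?F = "insert z (insert y F)"
    have "(x, y) \<in> (step_rel m ?F)\<^sup>*"
      using F(4) rtrancl_mono[OF step_rel_mono[of F ?F m]] by blast
    moreover have "(y, z) \<in> step_rel m ?F" using step.hyps(2) by (auto simp: step_rel_def)
    ultimately have "(x, z) \<in> (step_rel m ?F)\<^sup>*" by (rule rtrancl_into_rtrancl)
    moreover have "?F \<subseteq> S" using F(2) step.hyps(2) by (auto simp: step_rel_def)
    ultimately show ?case using F(1,3) by (intro exI[of _ ?F]) simp
  qed
  then show ?thesis using that by blast
qed

text \<open>An \<open>m\<close>-chain cannot cross a shell of width \<open>m\<close>.\<close>

lemma bounded_components_shell_exchange: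
  fixes m D \<rho> :: real
  assumes A: "A \<subseteq> M" and Z: "bounded_components m D (A - Z)" and D: "2 * \<rho> \<le> D"
    and v: "v \<in> M"
  shows "bounded_components m D
    (A - ((Z - mcball v \<rho>) \<union> A \<inter> (mcball v (\<rho> + m) - mcball v \<rho>)))"
    (is "bounded_components m D ?C")
  unfolding bounded_components_def
proof (intro ballI allI impI)
  fix x y assume x: "x \<in> ?C" and xy: "(x, y) \<in> (step_rel m ?C)\<^sup>*"
  have "(x \<in> mcball v \<rho> \<and> y \<in> mcball v \<rho>)
      \<or> (x \<in> A - Z \<and> y \<notin> mcball v \<rho> \<and> (x, y) \<in> (step_rel m (A - Z))\<^sup>*)"
    using xy
  proof (induction rule: rtrancl_induct)
    case base
    then show ?case using x by auto
  next
    case (step y z)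
    have yz: "y \<in> ?C" "z \<in> ?C" "d y z \<le> m" using step.hyps(2) by (auto simp: step_rel_def)
    then have yzM: "y \<in> M" "z \<in> M" using A by auto
    have "d v z \<le> d v y + m" "d v y \<le> d v z + m"
      using triangle[OF v yzM] triangle[OF v yzM(2) yzM(1)] yz(3) commute[of y z] by linarith+
    then have same: "y \<in> mcball v \<rho> \<longleftrightarrow> z \<in> mcball v \<rho>"
      using yz(1,2) v yzM by auto
    from step.IH show ?case
    proof
      assume *: "x \<in> A - Z \<and> y \<notin> mcball v \<rho> \<and> (x, y) \<in> (step_rel m (A - Z))\<^sup>*"
      then have "(y, z) \<in> step_rel m (A - Z)"
        using same yz by (auto simp: step_rel_def)
      then show ?thesis using * same by (meson rtrancl_into_rtrancl)
    qed (use same in blast)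
  qed
  then show "d x y \<le> D"
  proof
    assume "x \<in> mcball v \<rho> \<and> y \<in> mcball v \<rho>"
    then have "d x y \<le> 2 * \<rho>"
      using triangle[of x v y] commute[of x v] by auto
    then show ?thesis using D by linarith
  qed (use Z in \<open>auto simp: bounded_components_def\<close>)
qed

lemma minimal_separator_sparse:
  fixes N :: nat and m D r :: real
  assumes A: "A \<subseteq> M" and m: "m \<ge> 0" and v: "v \<in> A" and ZA: "Z \<subseteq> A"
    and Z: "bounded_components m D (A - Z)" and D: "2 * (r + N * m) \<le> D"
    and F: "finite F" "A \<inter> mcball v (r + N * m) \<subseteq> F"
    and min: "\<And>Z'. Z' \<subseteq> A \<Longrightarrow> bounded_components m D (A - Z') \<Longrightarrow> card (Z \<inter> F) \<le> card (Z' \<inter> F)"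
  shows "N * card (Z \<inter> mcball v r) \<le> card (A \<inter> mcball v (r + N * m))"
proof -
  define B where "B i = mcball v (r + real i * m)" for i :: nat
  have B_mono: "B i \<subseteq> B j" if "i \<le> j" for i j
    unfolding B_def using that m by (intro mcball_subset_concentric) (simp add: mult_right_mono)
  have BF: "A \<inter> B i \<subseteq> F" if "i \<le> N" for i
    using F(2) B_mono[OF that] by (auto simp: B_def)
  have shell: "card (A \<inter> B i) + card (Z \<inter> mcball v r) \<le> card (A \<inter> B (Suc i))" if i: "i < N" for i
  proof -
    define Z' where "Z' = (Z - B i) \<union> A \<inter> (B (Suc i) - B i)"
    have Suc_B: "B (Suc i) = mcball v ((r + i * m) + m)"
      by (simp add: B_def algebra_simps)
    have "2 * (r + i * m) \<le> 2 * (r + N * m)" using i m by (simp add: mult_right_mono)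
    then have "bounded_components m D (A - Z')"
      using bounded_components_shell_exchange[OF A Z, of "r + i * m" v] D v A
      unfolding Z'_def Suc_B unfolding B_def by (meson order_trans subsetD)
    then have "card (Z \<inter> F) \<le> card (Z' \<inter> F)" using ZA by (intro min) (auto simp: Z'_def)
    also have "\<dots> \<le> card ((Z - B i) \<inter> F) + card (A \<inter> (B (Suc i) - B i))"
    proof -
      have "Z' \<inter> F \<subseteq> ((Z - B i) \<inter> F) \<union> A \<inter> (B (Suc i) - B i)" by (auto simp: Z'_def)
      moreover have "finite (A \<inter> (B (Suc i) - B i))"
        using BF[of "Suc i"] i F(1) by (auto intro: finite_subset)
      ultimately have "card (Z' \<inter> F) \<le> card (((Z - B i) \<inter> F) \<union> A \<inter> (B (Suc i) - B i))"
        using F(1) by (intro card_mono) auto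
      then show ?thesis using card_Un_le order_trans by blast
    qed
    finally have le: "card (Z \<inter> F) \<le> card ((Z - B i) \<inter> F) + card (A \<inter> (B (Suc i) - B i))" .
    have "card (Z \<inter> F) = card ((Z - B i) \<inter> F) + card (Z \<inter> B i)"
    proof -
      have "Z \<inter> F = ((Z - B i) \<inter> F) \<union> (Z \<inter> B i)" using BF[of i] i ZA by auto
      moreover have "finite (Z \<inter> B i)" using BF[of i] i ZA F(1) by (auto intro: finite_subset)
      ultimately show ?thesis
        using F(1) card_Un_disjoint[of "(Z - B i) \<inter> F" "Z \<inter> B i"] by auto
    qed
    with le have "card (Z \<inter> B i) \<le> card (A \<inter> (B (Suc i) - B i))" by simp
    moreover have "card (Z \<inter> mcball v r) \<le> card (Z \<inter> B i)"
      using B_mono[of 0 i] BF[of i] i ZA F(1)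
      by (intro card_mono) (auto simp: B_def intro: finite_subset)
    moreover have "card (A \<inter> B (Suc i)) = card (A \<inter> B i) + card (A \<inter> (B (Suc i) - B i))"
    proof -
      have "A \<inter> B (Suc i) = (A \<inter> B i) \<union> A \<inter> (B (Suc i) - B i)" using B_mono[of i "Suc i"] by auto
      moreover have "finite (A \<inter> B (Suc i))"
        using BF[of "Suc i"] i F(1) by (auto intro: finite_subset)
      ultimately show ?thesis
        using card_Un_disjoint[of "A \<inter> B i" "A \<inter> (B (Suc i) - B i)"] by auto
    qed
    ultimately show ?thesis by linarith
  qed
  have "i \<le> N \<Longrightarrow> i * card (Z \<inter> mcball v r) \<le> card (A \<inter> B i)" for i
  proof (induction i)
    case (Suc i)
    then show ?case using shell[of i] by simp
  qed simp
  then show ?thesis by (auto simp: B_def)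
qed

lemma sparse_separator_exists:
  fixes N :: nat and m r :: real
  assumes A: "A \<subseteq> M" and m: "m \<ge> 0"
    and fin: "\<And>v. v \<in> A \<Longrightarrow> finite (A \<inter> mcball v (r + N * m))"
  obtains Z where "Z \<subseteq> A" "bounded_components m (2 * (r + N * m)) (A - Z)"
    "\<And>v. v \<in> A \<Longrightarrow> N * card (Z \<inter> mcball v r) \<le> card (A \<inter> mcball v (r + N * m))"
proof -
  define D where "D = 2 * (r + N * m)"
  define valid where "valid Z \<longleftrightarrow> Z \<subseteq> A \<and> bounded_components m D (A - Z)" for Z
  have "valid A" by (simp add: valid_def bounded_components_def)
  define X where "X F = arg_min (\<lambda>Z. card (Z \<inter> F)) valid" for F
  have X: "valid (X F)" "\<And>Z. valid Z \<Longrightarrow> card (X F \<inter> F) \<le> card (Z \<inter> F)" for F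
    unfolding X_def using arg_min_nat_lemma[of valid A "\<lambda>Z. card (Z \<inter> F)"] \<open>valid A\<close> by auto
  obtain Z where Z: "\<And>F. finite F \<Longrightarrow> \<exists>G. finite G \<and> F \<subseteq> G \<and> Z \<inter> F = X G \<inter> F"
    using rado_selection[of X] by blast
  have ZA: "Z \<subseteq> A"
  proof
    fix x assume "x \<in> Z"
    moreover obtain G where "Z \<inter> {x} = X G \<inter> {x}" using Z[of "{x}"] by auto
    ultimately show "x \<in> A" using X(1)[of G] by (auto simp: valid_def)
  qed
  show ?thesis
  proof (rule that[OF ZA])
    show "bounded_components m (2 * (r + N * m)) (A - Z)"
      unfolding bounded_components_def
    proof (intro ballI allI impI)
      fix x y assume "x \<in> A - Z" "(x, y) \<in> (step_rel m (A - Z))\<^sup>*"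
      then obtain F where F: "finite F" "F \<subseteq> A - Z" "x \<in> F" "(x, y) \<in> (step_rel m F)\<^sup>*"
        using step_rel_rtrancl_finite by metis
      obtain G where "Z \<inter> F = X G \<inter> F" using Z[OF F(1)] by auto
      then have FG: "F \<subseteq> A - X G" using F(2) by auto
      then have "(x, y) \<in> (step_rel m (A - X G))\<^sup>*"
        using F(4) rtrancl_mono[OF step_rel_mono] by blast
      then show "d x y \<le> 2 * (r + N * m)"
        using X(1)[of G] FG F(3) by (auto simp: valid_def bounded_components_def D_def)
    qed
    fix v assume v: "v \<in> A"
    obtain G where G: "finite G" "A \<inter> mcball v (r + N * m) \<subseteq> G"
      "Z \<inter> (A \<inter> mcball v (r + N * m)) = X G \<inter> (A \<inter> mcball v (r + N * m))"
      using Z[OF fin[OF v]] by auto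
    have "mcball v r \<subseteq> mcball v (r + N * m)"
      using m by (intro mcball_subset_concentric) simp
    then have "Z \<inter> mcball v r = X G \<inter> mcball v r"
      using G(3) ZA X(1)[of G] unfolding valid_def by blast
    then show "N * card (Z \<inter> mcball v r) \<le> card (A \<inter> mcball v (r + N * m))"
      using minimal_separator_sparse[OF A m v _ _ _ G(1,2), of "X G" D] X(1)[of G] X(2)[of _ G]
      by (simp add: valid_def D_def)
  qed
qed

lemma bounded_components_partition:
  assumes "bounded_components m D C"
  obtains \<U> where "\<Union>\<U> = C" "\<forall>U\<in>\<U>. \<forall>x\<in>U. \<forall>y\<in>U. d x y \<le> D"
    "\<forall>S. (\<forall>x\<in>S. \<forall>y\<in>S. d x y \<le> m) \<longrightarrow>
      finite {U\<in>\<U>. U \<inter> S \<noteq> {}} \<and> card {U\<in>\<U>. U \<inter> S \<noteq> {}} \<le> 1"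
proof -
  define R where "R = (step_rel m C)\<^sup>*"
  have symR: "sym R" unfolding R_def by (rule sym_rtrancl[OF sym_step_rel])
  have transR: "trans R" unfolding R_def by (rule trans_rtrancl)
  have closed: "(x, y) \<in> R \<Longrightarrow> x \<in> C \<Longrightarrow> y \<in> C" for x y
    unfolding R_def by (rule step_rel_rtrancl_closed)
  show ?thesis
  proof (rule that[of "(\<lambda>x. R `` {x}) ` C"])
    show "(\<Union>x\<in>C. R `` {x}) = C" using closed by (auto simp: R_def)
    show "\<forall>U\<in>(\<lambda>x. R `` {x}) ` C. \<forall>x\<in>U. \<forall>y\<in>U. d x y \<le> D"
    proof clarsimp
      fix c x y assume *: "c \<in> C" "(c, x) \<in> R" "(c, y) \<in> R"
      then have "(x, y) \<in> R" using symR transR by (meson symD transD)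
      then show "d x y \<le> D"
        using assms closed[OF *(2,1)] by (auto simp: bounded_components_def R_def)
    qed
    show "\<forall>S. (\<forall>x\<in>S. \<forall>y\<in>S. d x y \<le> m) \<longrightarrow> finite {U \<in> (\<lambda>x. R `` {x}) ` C. U \<inter> S \<noteq> {}}
        \<and> card {U \<in> (\<lambda>x. R `` {x}) ` C. U \<inter> S \<noteq> {}} \<le> 1"
    proof (intro allI impI)
      fix S assume S: "\<forall>x\<in>S. \<forall>y\<in>S. d x y \<le> m"
      let ?W = "{U \<in> (\<lambda>x. R `` {x}) ` C. U \<inter> S \<noteq> {}}"
      have eq: "U = U'" if "U \<in> ?W" "U' \<in> ?W" for U U'
      proof -
        obtain a s where a: "U = R `` {a}" "a \<in> C" "(a, s) \<in> R" "s \<in> S" using \<open>U \<in> ?W\<close> by auto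
        obtain b t where b: "U' = R `` {b}" "b \<in> C" "(b, t) \<in> R" "t \<in> S" using \<open>U' \<in> ?W\<close> by auto
        have "(s, t) \<in> R"
          using S closed[OF a(3,2)] closed[OF b(3,2)] a(4) b(4)
          by (auto simp: R_def step_rel_def)
        then have "(a, b) \<in> R" using a b symR transR by (meson symD transD)
        moreover have "equiv UNIV R" using symR transR by (simp add: equiv_def R_def refl_rtrancl)
        ultimately show ?thesis using a(1) b(1) equiv_class_eq by metis
      qed
      have "?W \<subseteq> {U}" if "U \<in> ?W" for U using eq that by blast
      then have "\<exists>U. ?W \<subseteq> {U}" by (cases "?W = {}") blast+
      then obtain U where U: "?W \<subseteq> {U}" by blast
      then show "finite ?W \<and> card ?W \<le> 1"
        using finite_subset[OF U] card_mono[OF _ U] by simp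
    qed
  qed
qed

lemma cover_of_slow_growth:
  fixes N :: nat and m :: real
  assumes "A \<subseteq> M" "m \<ge> 0"
    and "\<And>v. v \<in> A \<Longrightarrow> finite (A \<inter> mcball v (j * N * m)) \<and> card (A \<inter> mcball v (j * N * m)) < N ^ j"
  shows "\<exists>\<U>. \<Union>\<U> = A \<and> (\<forall>U\<in>\<U>. \<forall>x\<in>U. \<forall>y\<in>U. d x y \<le> 2 * (j * N * m)) \<and>
    (\<forall>S. (\<forall>x\<in>S. \<forall>y\<in>S. d x y \<le> m) \<longrightarrow>
      finite {U\<in>\<U>. U \<inter> S \<noteq> {}} \<and> card {U\<in>\<U>. U \<inter> S \<noteq> {}} \<le> j)"
  using assms
proof (induction j arbitrary: A)
  case 0
  have "A = {}"
  proof (rule ccontr)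
    assume "A \<noteq> {}"
    then obtain v where v: "v \<in> A" by blast
    then have "v \<in> A \<inter> mcball v 0" using 0 by auto
    then show False using 0(3)[OF v] by auto
  qed
  then show ?case by (intro exI[of _ "{}"]) auto
next
  case (Suc j)
  note m = \<open>m \<ge> 0\<close>
  have radius: "real (Suc j * N) * m = real (j * N) * m + N * m" by (simp add: algebra_simps)
  note grow = Suc.prems(3)[unfolded radius]
  obtain Z where Z: "Z \<subseteq> A" "bounded_components m (2 * (j * N * m + N * m)) (A - Z)"
    "\<And>v. v \<in> A \<Longrightarrow> N * card (Z \<inter> mcball v (j * N * m)) \<le> card (A \<inter> mcball v (j * N * m + N * m))"
    using sparse_separator_exists[OF Suc.prems(1,2), of "j * N * m" N] grow by auto
  have "\<exists>\<U>. \<Union>\<U> = Z \<and> (\<forall>U\<in>\<U>. \<forall>x\<in>U. \<forall>y\<in>U. d x y \<le> 2 * (j * N * m)) \<and>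
    (\<forall>S. (\<forall>x\<in>S. \<forall>y\<in>S. d x y \<le> m) \<longrightarrow>
      finite {U\<in>\<U>. U \<inter> S \<noteq> {}} \<and> card {U\<in>\<U>. U \<inter> S \<noteq> {}} \<le> j)"
  proof (rule Suc.IH[OF _ m])
    show "Z \<subseteq> M" using Z(1) Suc.prems(1) by blast
    fix v assume "v \<in> Z"
    then have v: "v \<in> A" using Z(1) by blast
    have "mcball v (j * N * m) \<subseteq> mcball v (j * N * m + N * m)"
      using m by (intro mcball_subset_concentric) simp
    then have "Z \<inter> mcball v (j * N * m) \<subseteq> A \<inter> mcball v (j * N * m + N * m)"
      using Z(1) by blast
    moreover have "N * card (Z \<inter> mcball v (j * N * m)) < N * N ^ j"
      using Z(3)[OF v] grow[OF v] unfolding power_Suc by (meson le_less_trans)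
    ultimately show "finite (Z \<inter> mcball v (j * N * m)) \<and> card (Z \<inter> mcball v (j * N * m)) < N ^ j"
      using grow[OF v] by (meson finite_subset mult_less_cancel1)
  qed
  then obtain \<U> where \<U>: "\<Union>\<U> = Z" "\<forall>U\<in>\<U>. \<forall>x\<in>U. \<forall>y\<in>U. d x y \<le> 2 * (j * N * m)"
    "\<And>S. \<forall>x\<in>S. \<forall>y\<in>S. d x y \<le> m \<Longrightarrow>
      finite {U\<in>\<U>. U \<inter> S \<noteq> {}} \<and> card {U\<in>\<U>. U \<inter> S \<noteq> {}} \<le> j"
    by blast
  obtain \<W> where \<W>: "\<Union>\<W> = A - Z" "\<forall>U\<in>\<W>. \<forall>x\<in>U. \<forall>y\<in>U. d x y \<le> 2 * (j * N * m + N * m)"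
    "\<forall>S. (\<forall>x\<in>S. \<forall>y\<in>S. d x y \<le> m) \<longrightarrow>
      finite {U\<in>\<W>. U \<inter> S \<noteq> {}} \<and> card {U\<in>\<W>. U \<inter> S \<noteq> {}} \<le> 1"
    by (rule bounded_components_partition[OF Z(2)])
  show ?case unfolding radius
  proof (intro exI[of _ "\<U> \<union> \<W>"] conjI allI impI)
    show "\<Union>(\<U> \<union> \<W>) = A" unfolding Union_Un_distrib \<U>(1) \<W>(1) using Z(1) by blast
    show "\<forall>U\<in>\<U> \<union> \<W>. \<forall>x\<in>U. \<forall>y\<in>U. d x y \<le> 2 * (j * N * m + N * m)"
    proof (intro ballI)
      fix U x y assume "U \<in> \<U> \<union> \<W>" and xy: "x \<in> U" "y \<in> U"
      then consider "U \<in> \<U>" | "U \<in> \<W>" by blast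
      then show "d x y \<le> 2 * (j * N * m + N * m)"
      proof cases
        case 1
        then have "d x y \<le> 2 * (j * N * m)" using \<U>(2) xy by blast
        also have "\<dots> \<le> 2 * (j * N * m + N * m)" using m by simp
        finally show ?thesis .
      next
        case 2
        then show ?thesis using \<W>(2) xy by blast
      qed
    qed
    fix S assume S: "\<forall>x\<in>S. \<forall>y\<in>S. d x y \<le> m"
    have eq: "{U\<in>\<U> \<union> \<W>. U \<inter> S \<noteq> {}} = {U\<in>\<U>. U \<inter> S \<noteq> {}} \<union> {U\<in>\<W>. U \<inter> S \<noteq> {}}" by auto
    show "finite {U\<in>\<U> \<union> \<W>. U \<inter> S \<noteq> {}}"
      unfolding eq using \<U>(3)[OF S] mp[OF spec[OF \<W>(3)] S] by simp
    show "card {U\<in>\<U> \<union> \<W>. U \<inter> S \<noteq> {}} \<le> Suc j"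
      unfolding eq using \<U>(3)[OF S] mp[OF spec[OF \<W>(3)] S]
        card_Un_le[of "{U\<in>\<U>. U \<inter> S \<noteq> {}}" "{U\<in>\<W>. U \<inter> S \<noteq> {}}"] by linarith
  qed
qed

lemma cover_from_net:
  fixes b m D :: real
  assumes A: "A \<subseteq> M" and net: "\<And>x. x \<in> M \<Longrightarrow> \<exists>a\<in>A. d x a \<le> b"
    and \<U>: "\<Union>\<U> = A" "\<forall>U\<in>\<U>. \<forall>x\<in>U. \<forall>y\<in>U. d x y \<le> D"
      "\<And>S. \<forall>x\<in>S. \<forall>y\<in>S. d x y \<le> 2 * (m + b) \<Longrightarrow>
        finite {U\<in>\<U>. U \<inter> S \<noteq> {}} \<and> card {U\<in>\<U>. U \<inter> S \<noteq> {}} \<le> n"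
  obtains \<W> where "\<Union>\<W> = M" "\<forall>W\<in>\<W>. \<forall>x\<in>W. \<forall>y\<in>W. d x y \<le> D + 2 * b"
    "\<forall>c\<in>M. finite {W\<in>\<W>. W \<inter> mcball c m \<noteq> {}} \<and> card {W\<in>\<W>. W \<inter> mcball c m \<noteq> {}} \<le> n"
proof -
  define nbh where "nbh U = {x\<in>M. \<exists>a\<in>U. d x a \<le> b}" for U
  show ?thesis
  proof (rule that[of "nbh ` \<U>"])
    show "\<Union>(nbh ` \<U>) = M" using net \<U>(1) by (fastforce simp: nbh_def)
    show "\<forall>W\<in>nbh ` \<U>. \<forall>x\<in>W. \<forall>y\<in>W. d x y \<le> D + 2 * b"
    proof clarify
      fix U x y assume U: "U \<in> \<U>" and "x \<in> nbh U" "y \<in> nbh U"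
      then obtain a a' where *: "x \<in> M" "y \<in> M" "a \<in> U" "d x a \<le> b" "a' \<in> U" "d y a' \<le> b"
        by (auto simp: nbh_def)
      then have "a \<in> M" "a' \<in> M" "d a a' \<le> D" using U \<U>(1,2) A by auto
      then show "d x y \<le> D + 2 * b"
        using * triangle[of x a y] triangle[of a a' y] commute[of y a'] by simp
    qed
    show "\<forall>c\<in>M. finite {W\<in>nbh ` \<U>. W \<inter> mcball c m \<noteq> {}}
        \<and> card {W\<in>nbh ` \<U>. W \<inter> mcball c m \<noteq> {}} \<le> n"
    proof
      fix c assume c: "c \<in> M"
      define S where "S = {a\<in>M. d c a \<le> m + b}"
      have "\<forall>x\<in>S. \<forall>y\<in>S. d x y \<le> 2 * (m + b)"
      proof (intro ballI)
        fix x y assume "x \<in> S" "y \<in> S"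
        then show "d x y \<le> 2 * (m + b)"
          using triangle[of x c y] c commute[of x c] by (auto simp: S_def)
      qed
      note fin = \<U>(3)[OF this]
      have sub: "{W\<in>nbh ` \<U>. W \<inter> mcball c m \<noteq> {}} \<subseteq> nbh ` {U\<in>\<U>. U \<inter> S \<noteq> {}}"
      proof clarify
        fix U assume U: "U \<in> \<U>" and "nbh U \<inter> mcball c m \<noteq> {}"
        then obtain x a where *: "x \<in> M" "a \<in> U" "d x a \<le> b" "d c x \<le> m"
          by (auto simp: nbh_def)
        then have "a \<in> M" using U \<U>(1) A by auto
        then have "a \<in> S" using * triangle[of c x a] c by (auto simp: S_def)
        then show "nbh U \<in> nbh ` {U\<in>\<U>. U \<inter> S \<noteq> {}}" using U * by blast
      qed
      then show "finite {W\<in>nbh ` \<U>. W \<inter> mcball c m \<noteq> {}}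
          \<and> card {W\<in>nbh ` \<U>. W \<inter> mcball c m \<noteq> {}} \<le> n"
        using fin finite_subset[OF sub] card_mono[OF _ sub]
          card_image_le[of "{U\<in>\<U>. U \<inter> S \<noteq> {}}" nbh] by fastforce
    qed
  qed
qed

end

lemma segment_length_le_1:
  assumes "x \<in> closed_edge e" "y \<in> closed_edge e"
  shows "segment_length e x y \<le> 1"
proof -
  have "(\<Sum>v\<in>e. \<bar>x v - y v\<bar>) \<le> (\<Sum>v\<in>e. x v + y v)"
    using assms by (intro sum_mono) (auto simp: closed_edge_def abs_le_iff add_increasing add_increasing2)
  also have "\<dots> = 2" using assms by (simp add: closed_edge_def sum.distrib)
  finally show ?thesis by (simp add: segment_length_def)
qed

lemma vertices_are_net:
  assumes g: "simple_graph V E" and x: "x \<in> graph_points V E"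
  shows "\<exists>a\<in>vertex_point ` V. graph_dist E x a \<le> 1"
proof (cases "x \<in> vertex_point ` V")
  case True
  then show ?thesis using graph_dist_le[OF pl_path_refl, of E x] by force
next
  case False
  then obtain e where e: "e \<in> E" "x \<in> closed_edge e" using x by (auto simp: graph_points_def)
  then obtain v where v: "v \<in> e" "v \<in> V"
    using g unfolding simple_graph_def by (metis card.empty ex_in_conv subsetD zero_neq_numeral)
  note ve = vertex_point_closed_edge[OF g e(1) v(1)]
  have "graph_dist E x (vertex_point v) \<le> 1"
    using graph_dist_le[OF pl_path_segment[OF e ve]] segment_length_le_1[OF e(2) ve] by linarith
  then show ?thesis using v(2) by blast
qed

lemma inj_vertex_point: "inj vertex_point"
  by (auto simp: inj_def vertex_point_def fun_eq_iff split: if_splits)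

lemma card_vertices_less:
  assumes "vertex_count V B < of_nat n"
  shows "finite (vertex_point ` V \<inter> B) \<and> card (vertex_point ` V \<inter> B) < n"
proof -
  let ?S = "{v\<in>V. vertex_point v \<in> B}"
  have eq: "vertex_point ` V \<inter> B = vertex_point ` ?S" by auto
  have "finite ?S"
    using assms by (rule_tac ccontr) (simp add: vertex_count_def)
  moreover from this have "card ?S < n"
    using assms by (simp add: vertex_count_def)
  moreover have "card (vertex_point ` ?S) = card ?S"
    by (intro card_image inj_on_subset[OF inj_vertex_point]) simp
  ultimately show ?thesis unfolding eq by simp
qed

lemma growth_scale:
  fixes c :: real
  assumes lim: "((\<lambda>r::real. growth V E r / ennreal (r ^ n)) \<longlongrightarrow> 0) at_top" and c: "c > 0"
  obtains N :: nat where "growth V E (c * N) < of_nat (N ^ n)"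
proof -
  have "eventually (\<lambda>r. growth V E r / ennreal (r ^ n) < ennreal (1 / c ^ n)) at_top"
    using c by (intro order_tendstoD(2)[OF lim]) simp
  moreover have "filterlim (\<lambda>N::nat. c * real N) at_top sequentially"
    using c by (intro filterlim_tendsto_pos_mult_at_top[OF tendsto_const _ filterlim_real_sequentially])
  ultimately have "eventually (\<lambda>N::nat. growth V E (c * N) / ennreal ((c * N) ^ n) < ennreal (1 / c ^ n)) sequentially"
    by (rule eventually_compose_filterlim)
  then obtain N0 where N0: "growth V E (c * real N) / ennreal ((c * N) ^ n) < ennreal (1 / c ^ n)"
    if "N \<ge> N0" for N
    unfolding eventually_sequentially by blast
  define N where "N = Suc N0"
  have N: "growth V E (c * real N) / ennreal ((c * N) ^ n) < ennreal (1 / c ^ n)" "N > 0"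
    using N0[of N] by (simp_all add: N_def)
  have pos: "(c * N) ^ n > 0" using c N(2) by simp
  have "growth V E (c * N) < ennreal (1 / c ^ n) * ennreal ((c * N) ^ n)"
    using N(1) pos by (subst (asm) divide_less_ennreal) (simp_all add: ennreal_eq_0_iff not_le)
  also have "\<dots> = of_nat (N ^ n)"
    using c by (simp add: ennreal_mult[symmetric] power_mult_distrib ennreal_of_nat_eq_real_of_nat)
  finally show ?thesis using that by blast
qed

theorem theorem2p4:
  fixes V :: "'v set" and E :: "'v set set" and k :: nat
  assumes "connected_graph V E"
    and "((\<lambda>r::real. growth V E r / ennreal (r ^ (k + 1))) \<longlongrightarrow> 0) at_top"
  shows "asdim (graph_points V E) (graph_dist E) \<le> enat k"
  unfolding asdim_le_iff asdim_at_most_def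
proof (intro allI impI)
  fix m :: real assume m: "m > 0"
  interpret Metric_space "graph_points V E" "graph_dist E"
    by (rule Metric_space_graph[OF assms(1)])
  have g: "simple_graph V E" using assms(1) by (simp add: connected_graph_def)
  define A where "A = vertex_point ` V"
  have A: "A \<subseteq> graph_points V E" by (auto simp: A_def graph_points_def)
  define m' where "m' = 2 * (m + 1)"
  have m': "m' > 0" using m by (simp add: m'_def)
  obtain N :: nat where N: "growth V E ((real (k + 1) * m') * N) < of_nat (N ^ (k + 1))"
    using growth_scale[OF assms(2), of "real (k + 1) * m'"] m' by auto
  have slow: "finite (A \<inter> mcball a (real ((k + 1) * N) * m')) \<and> card (A \<inter> mcball a (real ((k + 1) * N) * m')) < N ^ (k + 1)"
    if a: "a \<in> A" for a
  proof -
    obtain v where v: "v \<in> V" "a = vertex_point v" using a by (auto simp: A_def)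
    have r: "real (k + 1) * m' * N = real ((k + 1) * N) * m'" by (simp add: algebra_simps)
    have "vertex_count V (mcball a (real (k + 1) * m' * N)) \<le> growth V E (real (k + 1) * m' * N)"
      unfolding growth_def v(2) using v(1) by (rule SUP_upper)
    also note N
    finally show ?thesis unfolding A_def r by (rule card_vertices_less)
  qed
  obtain \<U> where \<U>: "\<Union>\<U> = A"
    "\<forall>U\<in>\<U>. \<forall>x\<in>U. \<forall>y\<in>U. graph_dist E x y \<le> 2 * (real ((k + 1) * N) * m')"
    "\<And>S. \<forall>x\<in>S. \<forall>y\<in>S. graph_dist E x y \<le> 2 * (m + 1) \<Longrightarrow>
      finite {U\<in>\<U>. U \<inter> S \<noteq> {}} \<and> card {U\<in>\<U>. U \<inter> S \<noteq> {}} \<le> k + 1"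
    using cover_of_slow_growth[OF A less_imp_le[OF m'] slow] unfolding m'_def by blast
  obtain \<W> where \<W>: "\<Union>\<W> = graph_points V E"
    "\<forall>W\<in>\<W>. \<forall>x\<in>W. \<forall>y\<in>W. graph_dist E x y \<le> 2 * (real ((k + 1) * N) * m') + 2 * 1"
    "\<forall>c\<in>graph_points V E. finite {W\<in>\<W>. W \<inter> mcball c m \<noteq> {}}
      \<and> card {W\<in>\<W>. W \<inter> mcball c m \<noteq> {}} \<le> k + 1"
    using cover_from_net[OF A _ \<U>, of 1 m] vertices_are_net[OF g] unfolding A_def by blast
  have "2 * (real ((k + 1) * N) * m') + 2 * 1 > 0"
    using m' by (simp add: add_nonneg_pos)
  then show "\<exists>D>0. \<exists>\<U>. \<Union>\<U> = graph_points V E \<and>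
      (\<forall>A\<in>\<U>. \<forall>x\<in>A. \<forall>y\<in>A. graph_dist E x y \<le> D) \<and>
      (\<forall>c\<in>graph_points V E. finite {A\<in>\<U>. A \<inter> mcball c m \<noteq> {}} \<and>
        card {A\<in>\<U>. A \<inter> mcball c m \<noteq> {}} \<le> k + 1)"
    using \<W> by blast
qed

end
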